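(* Let $n\in\mathbb{N}$ and $1\leqslant p<2$. Then the metric space $(\mathbb{P}^n,d_p)$, where $\mathbb{P}^n=\mathbb{R}^n\times\mathbb{R}$ and $d_p((x_1,t_1),(x_2,t_2))=(|x_1-x_2|^p+|t_1-t_2|^{p/2})^{1/p}$, does not satisfy the weak Besicovitch Covering Property (w-BCP).
   Context: $|x|$ denotes the Euclidean norm of $x\in\mathbb{R}^n$. In a metric space $(X,d)$, $B_r(x)$ denotes the closed ball with center $x$ and radius $r>0$. A family $\mathcal{B}$ of balls in a metric space $(X,d)$ is a Besicovitch family of balls if, first, for every ball $B_r(x)\in\mathcal{B}$ we have $x\notin B_\tau(y)$ for all $B_\tau(y)\in\mathcal{B}$ with $B_r(x)\neq B_\tau(y)$, and, second, $\bigcap_{B_r(x)\in\mathcal{B}}B_r(x)\neq\emptyset$. A metric space $(X,d)$ satisfies the weak Besicovitch Covering Property (w-BCP) if there exists a constant $M$ such that $\#\mathcal{B}\leqslant M$ for every Besicovitch family of balls $\mathcal{B}$ in $(X,d)$. *)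

theory Defs
  imports "HOL-Analysis.Analysis"
begin

context Metric_space
begin

text \<open>A ball is a subset of the space, which in a general metric space may have several centers
  and radii; the first clause of the separation condition ranges over all of them.\<close>

definition besicovitch_family :: "'a set set \<Rightarrow> bool" where
  "besicovitch_family \<B> \<longleftrightarrow>
     (\<forall>B\<in>\<B>. \<exists>x\<in>M. \<exists>r>0. B = mcball x r) \<and>
     (\<forall>x\<in>M. \<forall>r>0. \<forall>y\<in>M. \<forall>s>0.
        mcball x r \<in> \<B> \<longrightarrow> mcball y s \<in> \<B> \<longrightarrow> mcball x r \<noteq> mcball y s \<longrightarrow> x \<notin> mcball y s) \<and>
     M \<inter> \<Inter>\<B> \<noteq> {}"

definition w_BCP :: bool where
  "w_BCP \<longleftrightarrow> (\<exists>N::nat. \<forall>\<B>. besicovitch_family \<B> \<longrightarrow> finite \<B> \<and> card \<B> \<le> N)"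

end

definition parabolic_dist :: "real \<Rightarrow> (real ^ 'n) \<times> real \<Rightarrow> (real ^ 'n) \<times> real \<Rightarrow> real" where
  "parabolic_dist p = (\<lambda>(x1, t1) (x2, t2).
     (norm (x1 - x2) powr p + \<bar>t1 - t2\<bar> powr (p / 2)) powr (1 / p))"

lemma powr_convex_combination:
  fixes a b u v p :: real
  assumes "1 \<le> p" "0 \<le> a" "0 \<le> b" "0 < u" "0 < v" "u + v = 1"
  shows "(u * a + v * b) powr p \<le> u * a powr p + v * b powr p"
proof -
  have scale: "(w * c) powr p \<le> w * c powr p" if "0 < w" "w \<le> 1" "0 \<le> c" for w c :: real
  proof -
    have "w powr p \<le> w powr 1"
      using that assms(1) by (intro powr_mono') auto
    then have "w powr p * c powr p \<le> w * c powr p"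
      using that by (intro mult_right_mono) auto
    then show ?thesis
      using that by (simp add: powr_mult)
  qed
  consider "a = 0" | "b = 0" | "a > 0" "b > 0"
    using assms by linarith
  then show ?thesis
  proof cases
    case 1
    then show ?thesis using scale[of v b] assms by simp
  next
    case 2
    then show ?thesis using scale[of u a] assms by simp
  next
    case 3
    then show ?thesis
      using convex_onD[OF powr_convex[OF assms(1)], of v a b] assms by (simp add: eq_diff_eq[symmetric])
  qed
qed

lemma Minkowski_two:
  fixes a b c d p :: real
  assumes p: "1 \<le> p" and nn: "0 \<le> a" "0 \<le> b" "0 \<le> c" "0 \<le> d"
  shows "((a + c) powr p + (b + d) powr p) powr (1 / p)
         \<le> (a powr p + b powr p) powr (1 / p) + (c powr p + d powr p) powr (1 / p)"
proof -
  define S where "S = (a powr p + b powr p) powr (1 / p)"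
  define T where "T = (c powr p + d powr p) powr (1 / p)"
  have Sp: "S powr p = a powr p + b powr p" and Tp: "T powr p = c powr p + d powr p"
    using p by (simp_all add: S_def T_def powr_powr)
  have S0: "0 \<le> S" and T0: "0 \<le> T"
    by (simp_all add: S_def T_def)
  show ?thesis
  proof (cases "S = 0 \<or> T = 0")
    case True
    then show ?thesis
    proof
      assume "S = 0"
      then have "a powr p + b powr p = 0" using Sp by simp
      then have "a = 0 \<and> b = 0"
        by (metis add_nonneg_eq_0_iff powr_ge_zero powr_eq_0_iff)
      then show ?thesis using p by simp
    next
      assume "T = 0"
      then have "c powr p + d powr p = 0" using Tp by simp
      then have "c = 0 \<and> d = 0"
        by (metis add_nonneg_eq_0_iff powr_ge_zero powr_eq_0_iff)
      then show ?thesis using p by simp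
    qed
  next
    case False
    then have S: "0 < S" and T: "0 < T" using S0 T0 by auto
    define u where "u = S / (S + T)"
    define v where "v = T / (S + T)"
    have uv: "0 < u" "0 < v" "u + v = 1"
      using S T by (simp_all add: u_def v_def add_divide_distrib[symmetric])
    have step: "(x + y) powr p \<le> (S + T) powr p * (u * (x powr p / S powr p) + v * (y powr p / T powr p))"
      if "0 \<le> x" "0 \<le> y" for x y
    proof -
      have "x + y = (S + T) * (u * (x / S) + v * (y / T))"
        using S T by (simp add: u_def v_def distrib_left)
      then have "(x + y) powr p = (S + T) powr p * (u * (x / S) + v * (y / T)) powr p"
        using S T uv that by (simp add: powr_mult)
      also have "\<dots> \<le> (S + T) powr p * (u * (x / S) powr p + v * (y / T) powr p)"
        using S T uv that p by (intro mult_left_mono powr_convex_combination) auto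
      finally show ?thesis
        using S T that by (simp add: powr_divide)
    qed
    have "(a + c) powr p + (b + d) powr p
          \<le> (S + T) powr p * (u * (a powr p / S powr p) + v * (c powr p / T powr p))
            + (S + T) powr p * (u * (b powr p / S powr p) + v * (d powr p / T powr p))"
      using step[of a c] step[of b d] nn by (intro add_mono) auto
    also have "\<dots> = (S + T) powr p * (u * ((a powr p + b powr p) / S powr p)
                                     + v * ((c powr p + d powr p) / T powr p))"
      by (simp add: add_divide_distrib algebra_simps)
    also have "\<dots> = (S + T) powr p"
      using S T uv by (simp add: Sp[symmetric] Tp[symmetric])
    finally have "((a + c) powr p + (b + d) powr p) powr (1 / p) \<le> ((S + T) powr p) powr (1 / p)"
      using p by (intro powr_mono2) auto
    also have "\<dots> = S + T"
      using p S T by (simp add: powr_powr)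
    finally show ?thesis by (simp add: S_def T_def)
  qed
qed

lemma Metric_space_parabolic_dist:
  fixes p :: real
  assumes "1 \<le> p"
  shows "Metric_space UNIV (parabolic_dist p :: (real ^ 'n) \<times> real \<Rightarrow> _)"
proof
  have eq: "parabolic_dist p x y
      = (norm (fst x - fst y) powr p + sqrt \<bar>snd x - snd y\<bar> powr p) powr (1 / p)"
    for x y :: "(real ^ 'n) \<times> real"
    by (simp add: parabolic_dist_def case_prod_beta powr_half_sqrt[symmetric] powr_powr)
  fix x y z :: "(real ^ 'n) \<times> real"
  show "0 \<le> parabolic_dist p x y"
    by (simp add: eq)
  show "parabolic_dist p x y = parabolic_dist p y x"
    by (simp add: eq norm_minus_commute abs_minus_commute)
  show "parabolic_dist p x y = 0 \<longleftrightarrow> x = y"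
    by (simp add: eq add_nonneg_eq_0_iff prod_eq_iff)
  have "sqrt \<bar>snd x - snd z\<bar> \<le> sqrt (\<bar>snd x - snd y\<bar> + \<bar>snd y - snd z\<bar>)"
    by simp
  also have "\<dots> \<le> sqrt \<bar>snd x - snd y\<bar> + sqrt \<bar>snd y - snd z\<bar>"
    by (rule sqrt_add_le_add_sqrt) auto
  finally have t: "sqrt \<bar>snd x - snd z\<bar> \<le> sqrt \<bar>snd x - snd y\<bar> + sqrt \<bar>snd y - snd z\<bar>" .
  have n: "norm (fst x - fst z) \<le> norm (fst x - fst y) + norm (fst y - fst z)"
    using norm_triangle_ineq[of "fst x - fst y" "fst y - fst z"] by simp
  have "parabolic_dist p x z
      \<le> ((norm (fst x - fst y) + norm (fst y - fst z)) powr p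
         + (sqrt \<bar>snd x - snd y\<bar> + sqrt \<bar>snd y - snd z\<bar>) powr p) powr (1 / p)"
    unfolding eq using assms n t by (intro powr_mono2 add_mono) auto
  also have "\<dots> \<le> parabolic_dist p x y + parabolic_dist p y z"
    unfolding eq using assms by (intro Minkowski_two) auto
  finally show "parabolic_dist p x z \<le> parabolic_dist p x y + parabolic_dist p y z" .
qed

end

theory Submission
  imports Defs "HOL-Real_Asymp.Real_Asymp"
begin

text \<open>We exhibit an infinite Besicovitch family of balls, all with the origin on their boundary.
  The centers are \<open>(3\<^sup>-\<^sup>i u, t\<^sub>i)\<close> with \<open>u\<close> a unit vector and \<open>t\<^sub>i\<close> growing so fast
  that \<open>t\<^sub>j\<close> is huge compared with all earlier data. For \<open>i < j\<close> the distance between the two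
  centers clearly exceeds the distance from the \<open>i\<close>-th one to the origin. It also exceeds the
  distance from the \<open>j\<close>-th one to the origin: as \<open>p / 2 < 1\<close>, replacing \<open>t\<^sub>j\<close> by \<open>t\<^sub>j - t\<^sub>i\<close>
  changes its \<open>p / 2\<close>-th power arbitrarily little, while \<open>3\<^sup>-\<^sup>i - 3\<^sup>-\<^sup>j\<close> is larger
  than \<open>3\<^sup>-\<^sup>j\<close> by a fixed factor.\<close>

lemma parabolic_dist_powr:
  assumes "p \<noteq> 0"
  shows "parabolic_dist p x y powr p
    = norm (fst x - fst y) powr p + \<bar>snd x - snd y\<bar> powr (p / 2)"
  using assms by (simp add: parabolic_dist_def case_prod_beta powr_powr)

lemma parabolic_dist_nonneg: "0 \<le> parabolic_dist p x y"
  by (simp add: parabolic_dist_def case_prod_beta)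

lemma parabolic_dist_less_iff:
  assumes "0 < p"
  shows "parabolic_dist p x y < parabolic_dist p z w
    \<longleftrightarrow> parabolic_dist p x y powr p < parabolic_dist p z w powr p"
  using assms powr_less_mono2[OF assms parabolic_dist_nonneg]
    powr_mono2[OF less_imp_le[OF assms] parabolic_dist_nonneg]
  by (meson linorder_not_less)

text \<open>The separation clause of \<open>besicovitch_family\<close> ranges over all centers of a
  ball, so there must be only one. A second center would make the ball invariant under a nonzero
  translation, hence unbounded.\<close>

lemma parabolic_mcball_center_unique:
  fixes x y :: "(real ^ 'n) \<times> real"
  assumes p: "1 \<le> p" and r: "0 \<le> r"
    and eq: "Metric_space.mcball UNIV (parabolic_dist p) x r
      = Metric_space.mcball UNIV (parabolic_dist p) y s"
  shows "x = y"
proof (rule ccontr)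
  assume "x \<noteq> y"
  interpret Metric_space UNIV "parabolic_dist p :: (real ^ 'n) \<times> real \<Rightarrow> _"
    by (rule Metric_space_parabolic_dist[OF p])
  define v where "v = y - x"
  \<comment> \<open>The distance depends only on the sizes of coordinate differences, so a ball is
    symmetric about each of its centers.\<close>
  have reflect: "2 *\<^sub>R c - z \<in> mcball c \<rho>" if "z \<in> mcball c \<rho>" for c z :: "(real ^ 'n) \<times> real" and \<rho>
  proof -
    have e: "c - (2 *\<^sub>R c - z) = z - c"
      by (simp add: scaleR_2)
    have "parabolic_dist p c (2 *\<^sub>R c - z) = parabolic_dist p z c"
      by (simp only: parabolic_dist_def case_prod_beta fst_diff[symmetric] snd_diff[symmetric] e)
    then show ?thesis
      using that by (simp add: in_mcball commute)
  qed
  \<comment> \<open>Composing the two point reflections gives a translation that preserves the ball.\<close>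
  have "x + (2 * real k) *\<^sub>R v \<in> mcball x r" for k
  proof (induction k)
    case 0
    show ?case using r by (simp add: in_mcball)
  next
    case (Suc k)
    have "2 *\<^sub>R y - (2 *\<^sub>R x - (x + (2 * real k) *\<^sub>R v)) \<in> mcball x r"
      using reflect[OF Suc] reflect unfolding eq by blast
    also have "2 *\<^sub>R y - (2 *\<^sub>R x - (x + (2 * real k) *\<^sub>R v)) = x + (2 * real (Suc k)) *\<^sub>R v"
      by (simp add: v_def algebra_simps scaleR_2)
    finally show ?case .
  qed
  then have le: "parabolic_dist p x (x + (2 * real k) *\<^sub>R v) powr p \<le> r powr p" for k
    using p by (intro powr_mono2) (auto simp: in_mcball)
  define D where "D = parabolic_dist p 0 v powr p"
  have D: "0 < D"
    using p mdist_pos_less[of 0 v] \<open>x \<noteq> y\<close> by (simp add: D_def v_def)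
  \<comment> \<open>Scaling \<open>v\<close> by \<open>2 * k\<close> multiplies the two terms of
    \<open>D\<close> by powers with different exponents, \<open>p\<close> and \<open>p / 2\<close>;
    as \<open>2 * k \<ge> 1\<close>, the smaller exponent bounds both from below.\<close>
  have ge: "(2 * real k) powr (p / 2) * D \<le> r powr p" if "1 \<le> k" for k
  proof -
    have "(2 * real k) powr (p / 2) * norm (fst v) powr p
        \<le> (2 * real k) powr p * norm (fst v) powr p"
      using that p by (intro mult_right_mono powr_mono) auto
    then have "(2 * real k) powr (p / 2) * D
        \<le> parabolic_dist p x (x + (2 * real k) *\<^sub>R v) powr p"
      using p by (simp add: D_def parabolic_dist_powr distrib_left powr_mult abs_mult)
    then show ?thesis using le[of k] by linarith
  qed
  have "filterlim (\<lambda>k. (2 * real k) powr (p / 2) * D) at_top at_top"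
    using p D by real_asymp
  then have "eventually (\<lambda>k. r powr p < (2 * real k) powr (p / 2) * D \<and> 1 \<le> k) at_top"
    by (intro eventually_conj eventually_ge_at_top) (simp add: filterlim_at_top_dense)
  then obtain k where "r powr p < (2 * real k) powr (p / 2) * D" "1 \<le> k"
    using eventually_happens[of _ "at_top :: nat filter"] by auto
  then show False using ge[of k] by simp
qed

text \<open>The last two conditions are the separation inequalities in \<open>p\<close>-th powers:
  \<open>1\<close> bounds the horizontal term of the earlier center, and \<open>2 / 3 ^ j\<close> is
  a lower bound for the horizontal gap between the two centers.\<close>

lemma exists_rapid_heights:
  fixes p :: real
  assumes "0 < p" "p < 2"
  obtains t :: "nat \<Rightarrow> real" where "0 \<le> t 0" "strict_mono t"
    "\<And>i j. i < j \<Longrightarrow> 1 + t i powr (p / 2) < (t j - t i) powr (p / 2)"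
    "\<And>i j. i < j \<Longrightarrow> (1 / 3 ^ j) powr p + t j powr (p / 2)
        < (2 / 3 ^ j) powr p + (t j - t i) powr (p / 2)"
proof -
  define Q where "Q n a b \<longleftrightarrow> a < b \<and> 1 + a powr (p / 2) < (b - a) powr (p / 2) \<and>
     (1 / 3 ^ Suc n) powr p + b powr (p / 2) < (2 / 3 ^ Suc n) powr p + (b - a) powr (p / 2)"
    for n :: nat and a b :: real
  have ex: "\<exists>b\<ge>0. Q n a b" if "0 \<le> a" for n a
  proof -
    have "filterlim (\<lambda>b. (b - a) powr (p / 2)) at_top at_top"
      using assms by real_asymp
    then have 1: "eventually (\<lambda>b. 1 + a powr (p / 2) < (b - a) powr (p / 2)) at_top"
      by (simp add: filterlim_at_top_dense)
    \<comment> \<open>Here \<open>p < 2\<close> is decisive: for \<open>p = 2\<close> the difference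
      would equal \<open>a\<close> for all large \<open>b\<close>.\<close>
    have "((\<lambda>b. b powr (p / 2) - (b - a) powr (p / 2)) \<longlongrightarrow> 0) at_top"
      using assms by real_asymp
    moreover have "0 < (2 / 3 ^ Suc n) powr p - (1 / 3 ^ Suc n) powr p"
      using assms powr_less_mono2[of p "1 / 3 ^ Suc n" "2 / 3 ^ Suc n"]
      by (simp add: divide_strict_right_mono)
    ultimately have 2: "eventually (\<lambda>b. b powr (p / 2) - (b - a) powr (p / 2)
        < (2 / 3 ^ Suc n) powr p - (1 / 3 ^ Suc n) powr p) at_top"
      by (rule order_tendstoD)
    have "eventually (\<lambda>b. 0 \<le> b \<and> Q n a b) at_top"
      using 1 2 eventually_gt_at_top[of a]
      by eventually_elim (use that in \<open>auto simp: Q_def\<close>)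
    from eventually_happens[OF this] show ?thesis
      by simp
  qed
  have "\<exists>t. \<forall>n. 0 \<le> t n \<and> Q n (t n) (t (Suc n))"
    using dependent_nat_choice[of "\<lambda>_ b. 0 \<le> b" Q] ex by blast
  then obtain t where t0: "\<And>n. 0 \<le> t n" and Q: "\<And>n. Q n (t n) (t (Suc n))"
    by blast
  have sm: "strict_mono t"
    using Q by (simp add: strict_mono_Suc_iff Q_def)
  have *: "1 + t i powr (p / 2) < (t j - t i) powr (p / 2)
    \<and> (1 / 3 ^ j) powr p + t j powr (p / 2) < (2 / 3 ^ j) powr p + (t j - t i) powr (p / 2)"
    if "i < j" for i j
  proof -
    \<comment> \<open>Consecutive heights suffice: replacing \<open>m\<close> by a smaller
      \<open>i\<close> lowers \<open>t m\<close> and widens the gap to \<open>t j\<close>, which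
      only helps both inequalities.\<close>
    obtain m where j: "j = Suc m" and "i \<le> m"
      using \<open>i < j\<close> by (cases j) auto
    then have le: "t i \<le> t m"
      using sm by (simp add: strict_mono_less_eq)
    have "t m < t j"
      using sm by (simp add: j strict_mono_Suc_iff)
    then have "(t j - t m) powr (p / 2) \<le> (t j - t i) powr (p / 2)"
      using le assms by (intro powr_mono2) auto
    moreover have "t i powr (p / 2) \<le> t m powr (p / 2)"
      using le t0 assms by (intro powr_mono2) auto
    ultimately show ?thesis
      using Q[of m] unfolding Q_def j by linarith
  qed
  show ?thesis
    using that[OF t0 sm] * by blast
qed

text \<open>With radii equal to the distances to the origin, this says that no center lies in the
  ball of another.\<close>

lemma parabolic_infinite_separated_sequence:
  fixes p :: real
  assumes "0 < p" "p < 2"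
  obtains c :: "nat \<Rightarrow> (real ^ 'n) \<times> real" where
    "\<And>i j. i \<noteq> j \<Longrightarrow> parabolic_dist p (c i) 0 < parabolic_dist p (c i) (c j)"
proof -
  obtain t :: "nat \<Rightarrow> real" where t0: "0 \<le> t 0" and sm: "strict_mono t"
    and near: "\<And>i j. i < j \<Longrightarrow> 1 + t i powr (p / 2) < (t j - t i) powr (p / 2)"
    and far: "\<And>i j. i < j \<Longrightarrow> (1 / 3 ^ j) powr p + t j powr (p / 2)
        < (2 / 3 ^ j) powr p + (t j - t i) powr (p / 2)"
    using exists_rapid_heights[OF assms] by metis
  obtain u :: "real ^ 'n" where u: "norm u = 1"
    using norm_axis_1 by blast
  define c where "c i = ((1 / 3 ^ i) *\<^sub>R u, t i)" for i :: nat
  have tn: "0 \<le> t i" for i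
    using t0 strict_mono_less_eq[OF sm, of 0 i] by simp
  have origin: "parabolic_dist p (c i) 0 powr p = (1 / 3 ^ i) powr p + t i powr (p / 2)" for i
    using assms tn[of i] u by (simp add: parabolic_dist_powr c_def)
  have "parabolic_dist p (c i) 0 powr p < parabolic_dist p (c i) (c j) powr p
      \<and> parabolic_dist p (c j) 0 powr p < parabolic_dist p (c i) (c j) powr p" if "i < j" for i j
  proof -
    \<comment> \<open>The ratio \<open>1 / 3\<close> makes the horizontal gap at least twice the
      horizontal distance of \<open>c j\<close> from the origin.\<close>
    have "(3::real) ^ Suc i \<le> 3 ^ j"
      using that by (intro power_increasing) auto
    then have "2 / 3 ^ j \<le> 1 / 3 ^ i - 1 / (3::real) ^ j"
      by (simp add: field_simps)
    then have x: "(2 / 3 ^ j) powr p \<le> \<bar>1 / 3 ^ i - 1 / (3::real) ^ j\<bar> powr p"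
      using assms by (intro powr_mono2) auto
    have "(1 / 3 ^ i :: real) powr p \<le> 1"
      using assms powr_mono2[of p "1 / 3 ^ i" 1] by simp
    moreover have "parabolic_dist p (c i) (c j) powr p
        = \<bar>1 / 3 ^ i - 1 / 3 ^ j\<bar> powr p + (t j - t i) powr (p / 2)"
      using assms u strict_monoD[OF sm that]
      by (simp add: parabolic_dist_powr c_def abs_minus_commute flip: scaleR_diff_left)
    moreover have "0 \<le> \<bar>1 / 3 ^ i - 1 / (3::real) ^ j\<bar> powr p"
      by simp
    ultimately show ?thesis
      using near[OF that] far[OF that] x unfolding origin by (intro conjI) linarith+
  qed
  moreover have "parabolic_dist p (c i) (c j) = parabolic_dist p (c j) (c i)" for i j
    by (simp add: parabolic_dist_def case_prod_beta norm_minus_commute abs_minus_commute)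
  ultimately have "parabolic_dist p (c i) 0 < parabolic_dist p (c i) (c j)" if "i \<noteq> j" for i j
    using that parabolic_dist_less_iff[OF assms(1)] by (metis linorder_neqE_nat)
  then show ?thesis
    by (rule that)
qed

theorem theorem1p3:
  fixes p :: real
  assumes "1 \<le> p" and "p < 2"
  shows "\<not> Metric_space.w_BCP UNIV
           (parabolic_dist p :: (real ^ 'n) \<times> real \<Rightarrow> (real ^ 'n) \<times> real \<Rightarrow> real)"
proof -
  interpret Metric_space UNIV "parabolic_dist p :: (real ^ 'n) \<times> real \<Rightarrow> _"
    by (rule Metric_space_parabolic_dist[OF assms(1)])
  obtain c :: "nat \<Rightarrow> (real ^ 'n) \<times> real" where
    sep: "\<And>i j. i \<noteq> j \<Longrightarrow> parabolic_dist p (c i) 0 < parabolic_dist p (c i) (c j)"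
    using parabolic_infinite_separated_sequence[of p] assms by auto
  define r where "r i = parabolic_dist p (c i) 0" for i
  define B where "B i = mcball (c i) (r i)" for i
  have notin: "c i \<notin> B j" if "i \<noteq> j" for i j
    using sep[of j i] that by (simp add: B_def r_def in_mcball)
  have self: "c i \<in> B i" for i
    by (simp add: B_def r_def in_mcball)
  \<comment> \<open>If \<open>c i\<close> were the origin, separation of any other center from it
    would read \<open>d < d\<close>.\<close>
  have "c i \<noteq> 0" for i
    using sep[of i "Suc i"] sep[of "Suc i" i] commute[of "c i" "c (Suc i)"] by force
  then have r: "0 < r i" for i
    unfolding r_def by (intro mdist_pos_less) auto
  \<comment> \<open>The family is a set, so the balls must be distinct: \<open>c i\<close> lies in
    \<open>B i\<close> and in no other.\<close>
  have "inj B"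
    using notin self by (metis injI)
  then have "infinite (range B)"
    by (rule range_inj_infinite)
  moreover have "besicovitch_family (range B)"
    unfolding besicovitch_family_def
  proof (intro conjI)
    show "\<forall>b\<in>range B. \<exists>x\<in>UNIV. \<exists>\<rho>>0. b = mcball x \<rho>"
      using r unfolding B_def by blast
    show "\<forall>x\<in>UNIV. \<forall>\<rho>>0. \<forall>y\<in>UNIV. \<forall>\<sigma>>0. mcball x \<rho> \<in> range B \<longrightarrow> mcball y \<sigma> \<in> range B
        \<longrightarrow> mcball x \<rho> \<noteq> mcball y \<sigma> \<longrightarrow> x \<notin> mcball y \<sigma>"
    proof (intro ballI allI impI)
      fix x y :: "(real ^ 'n) \<times> real" and \<rho> \<sigma> :: real
      assume "0 < \<rho>" and ne: "mcball x \<rho> \<noteq> mcball y \<sigma>"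
        and "mcball x \<rho> \<in> range B" "mcball y \<sigma> \<in> range B"
      then obtain i j where i: "mcball x \<rho> = B i" and j: "mcball y \<sigma> = B j"
        by blast
      have "x = c i"
        using parabolic_mcball_center_unique[OF assms(1) _ i[unfolded B_def]] \<open>0 < \<rho>\<close> by simp
      moreover have "i \<noteq> j"
        using ne i j by auto
      ultimately show "x \<notin> mcball y \<sigma>"
        using notin j by simp
    qed
    have "0 \<in> B i" for i
      by (simp add: B_def r_def in_mcball)
    then show "UNIV \<inter> \<Inter> (range B) \<noteq> {}"
      by blast
  qed
  ultimately show ?thesis
    unfolding w_BCP_def by blast
qed

end
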